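(* Let $n\ge 1$. The clique complex $K_n$ is homotopy equivalent to the nerve $N_n:=N(\mathcal C_n)$ of the family $\mathcal C_n$ of all distinct full star- and full top-simplices: $K_n\simeq N_n$.
   Context: A partition of $n$ is a weakly decreasing sequence $\lambda=(\lambda_1\ge\cdots\ge\lambda_\ell>0)$ of positive integers with sum $n$, identified with its Ferrers diagram ($\lambda_i$ left-justified cells in row $i$); set $\lambda_{\ell+1}=0$. The partition graph $G_n$ has as vertices all partitions of $n$; two distinct partitions are adjacent if one is obtained from the other by removing one cell from a row, adding it to another row (possibly a new row of length $0$), and reordering the row lengths into weakly decreasing order. $K_n$ is the clique complex of $G_n$: its simplices are the finite nonempty cliques of $G_n$. A removable corner of $\lambda$ is the last cell of a row whose length is strictly greater than that of the next row; an addable corner is a position where a cell can be added so that the result is again a Ferrers diagram of a partition (row $\ell+1$ allowed). Write $r(\cdot)$ for the row number of a corner. For a removable corner $c$ and an addable corner $a$ of $\lambda$ with $r(c)\ne r(a)$, remove $c$ (decrease $\lambda_{r(c)}$ by $1$), add a cell at $a$ (increase $\lambda_{r(a)}$ by $1$), and reorder row lengths. If the result is a partition of $n$ different from $\lambda$, the transfer is called admissible and the result is denoted $\lambda(c\to a)$. The neighbors of $\lambda$ in $G_n$ are exactly the partitions $\lambda(c\to a)$ for admissible transfers. For a removable corner $c$ of $\lambda$: $A_{\max}(\lambda,c):=\{a:\lambda(c\to a)\text{ is admissible}\}$ and the full star-simplex is $\Sigma^{\mathrm{star}}_{\max}(\lambda,c):=\{\lambda\}\cup\{\lambda(c\to a):a\in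 A_{\max}(\lambda,c)\}$. For an addable corner $a$ of $\lambda$: $C_{\max}(\lambda,a):=\{c:\lambda(c\to a)\text{ is admissible}\}$ and the full top-simplex is $\Sigma^{\mathrm{top}}_{\max}(\lambda,a):=\{\lambda\}\cup\{\lambda(c\to a):c\in C_{\max}(\lambda,a)\}$. These are cliques, i.e. simplices of $K_n$. $\mathcal C_n$ is the set of all full star- and full top-simplices over all partitions $\lambda$ of $n$ and all their corners, with equal simplices identified. The nerve $N_n=N(\mathcal C_n)$ is the simplicial complex with vertex set $\mathcal C_n$ in which $\{U_0,\dots,U_p\}\subseteq\mathcal C_n$ is a simplex if and only if $U_0\cap\cdots\cap U_p\ne\varnothing$. *)

theory Defs
  imports "HOL-Analysis.Analysis"
begin

section \<open>Partitions and the partition graph\<close>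

text \<open>
  A partition is the list of its row lengths. Rows are numbered from \<open>0\<close>, so row \<open>length xs\<close> is
  the new row of length \<open>0\<close>.
\<close>

definition is_partition :: "nat \<Rightarrow> nat list \<Rightarrow> bool" where
  "is_partition n xs \<longleftrightarrow> sorted_wrt (\<ge>) xs \<and> (\<forall>x\<in>set xs. 0 < x) \<and> sum_list xs = n"

definition partitions :: "nat \<Rightarrow> nat list set" where
  "partitions n = {xs. is_partition n xs}"

definition reorder :: "nat list \<Rightarrow> nat list" where
  "reorder xs = rev (sort (filter (\<lambda>x. 0 < x) xs))"

text \<open>Intended for \<open>i < length xs\<close>, \<open>j \<le> length xs\<close>, \<open>i \<noteq> j\<close>.\<close>

definition move_cell :: "nat list \<Rightarrow> nat \<Rightarrow> nat \<Rightarrow> nat list" where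
  "move_cell xs i j = (let ys = xs @ [0] in reorder (ys[i := ys ! i - 1, j := ys ! j + 1]))"

definition obtained_by_move :: "nat list \<Rightarrow> nat list \<Rightarrow> bool" where
  "obtained_by_move xs ys \<longleftrightarrow>
     (\<exists>i j. i < length xs \<and> j \<le> length xs \<and> i \<noteq> j \<and> ys = move_cell xs i j)"

definition partition_adj :: "nat list \<Rightarrow> nat list \<Rightarrow> bool" where
  "partition_adj xs ys \<longleftrightarrow> xs \<noteq> ys \<and> (obtained_by_move xs ys \<or> obtained_by_move ys xs)"


section \<open>Corners and full simplices\<close>

text \<open>
  A row contains at most one removable and at most one addable corner, so a corner is represented
  by its row.
\<close>

definition row_length :: "nat list \<Rightarrow> nat \<Rightarrow> nat" where
  "row_length xs i = (if i < length xs then xs ! i else 0)"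

definition removable_corners :: "nat list \<Rightarrow> nat set" where
  "removable_corners xs = {i. i < length xs \<and> row_length xs (Suc i) < row_length xs i}"

definition add_cell :: "nat list \<Rightarrow> nat \<Rightarrow> nat list" where
  "add_cell xs i = (if i < length xs then xs[i := xs ! i + 1] else xs @ [1])"

definition addable_corners :: "nat list \<Rightarrow> nat set" where
  "addable_corners xs = {i. i \<le> length xs \<and> is_partition (sum_list xs + 1) (add_cell xs i)}"

definition admissible :: "nat list \<Rightarrow> nat \<Rightarrow> nat \<Rightarrow> bool" where
  "admissible xs c a \<longleftrightarrow>
     c \<in> removable_corners xs \<and> a \<in> addable_corners xs \<and> c \<noteq> a \<and>
     is_partition (sum_list xs) (move_cell xs c a) \<and> move_cell xs c a \<noteq> xs"

definition full_star :: "nat list \<Rightarrow> nat \<Rightarrow> nat list set" where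
  "full_star xs c = insert xs (move_cell xs c ` {a. admissible xs c a})"

definition full_top :: "nat list \<Rightarrow> nat \<Rightarrow> nat list set" where
  "full_top xs a = insert xs ((\<lambda>c. move_cell xs c a) ` {c. admissible xs c a})"

definition full_simplices :: "nat \<Rightarrow> nat list set set" where
  "full_simplices n =
     {full_star xs c | xs c. xs \<in> partitions n \<and> c \<in> removable_corners xs} \<union>
     {full_top xs a | xs a. xs \<in> partitions n \<and> a \<in> addable_corners xs}"


section \<open>Abstract simplicial complexes\<close>

text \<open>An abstract simplicial complex is given by its set of (finite, nonempty) simplices.\<close>

definition clique_complex :: "'a set \<Rightarrow> ('a \<Rightarrow> 'a \<Rightarrow> bool) \<Rightarrow> 'a set set" where
  "clique_complex V adj =
     {S. S \<subseteq> V \<and> finite S \<and> S \<noteq> {} \<and> (\<forall>x\<in>S. \<forall>y\<in>S. x \<noteq> y \<longrightarrow> adj x y)}"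

definition nerve :: "'a set set \<Rightarrow> 'a set set set" where
  "nerve \<C> = {S. S \<subseteq> \<C> \<and> finite S \<and> S \<noteq> {} \<and> \<Inter>S \<noteq> {}}"

text \<open>
  Points of the geometric realization are given by barycentric coordinates. The topology is
  inherited from the product topology on \<open>'a \<Rightarrow> real\<close>; for complexes with finitely many vertices,
  such as the ones below, this is the usual (weak) topology. For infinite complexes it can be
  strictly coarser.
\<close>

definition geometric_realization :: "'a set set \<Rightarrow> ('a \<Rightarrow> real) topology" where
  "geometric_realization K =
     top_of_set {f. (\<forall>v. 0 \<le> f v) \<and> {v. f v \<noteq> 0} \<in> K \<and> (\<Sum>v | f v \<noteq> 0. f v) = 1}"

definition partition_complex :: "nat \<Rightarrow> nat list set set" where
  "partition_complex n = clique_complex (partitions n) partition_adj"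

definition partition_nerve :: "nat \<Rightarrow> nat list set set set" where
  "partition_nerve n = nerve (full_simplices n)"

end

theory Submission
  imports Defs
begin

text \<open>
  Identify a partition with its Ferrers diagram. Two partitions of \<open>n\<close> are adjacent iff their
  diagrams share \<open>n - 1\<close> cells; the full star-simplices are the sets of all partitions of \<open>n\<close>
  containing a fixed diagram with \<open>n - 1\<close> cells, the full top-simplices those contained in a fixed
  diagram with \<open>n + 1\<close> cells. Pairwise adjacency of a family of diagrams forces one of the two
  containments, so the simplices of the clique complex are the nonempty subsets of full simplices.
  Hence the clique complex and the nerve are the two Dowker complexes of the membership relation
  between partitions and full simplices.

  For Dowker duality, a point \<open>f\<close> of one realization is sent to the normalization of
  \<open>b \<mapsto> max 0 (f {a. R a b} - (1 - e))\<close>. For small \<open>e\<close> this lands in the other realization, and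
  both composites are joined to the identity by straight lines.
\<close>


section \<open>Dowker duality\<close>

definition dowker_complex :: "'a set \<Rightarrow> 'b set \<Rightarrow> ('a \<Rightarrow> 'b \<Rightarrow> bool) \<Rightarrow> 'a set set" where
  "dowker_complex A B R = {S. S \<subseteq> A \<and> finite S \<and> S \<noteq> {} \<and> (\<exists>b\<in>B. \<forall>a\<in>S. R a b)}"

definition dowker_points :: "'a set \<Rightarrow> 'b set \<Rightarrow> ('a \<Rightarrow> 'b \<Rightarrow> bool) \<Rightarrow> ('a \<Rightarrow> real) set" where
  "dowker_points A B R =
     {f. (\<forall>a. 0 \<le> f a) \<and> (\<forall>a. a \<notin> A \<longrightarrow> f a = 0) \<and> sum f A = 1 \<and>
         (\<exists>b\<in>B. \<forall>a. f a \<noteq> 0 \<longrightarrow> R a b)}"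

text \<open>
  The weight of \<open>b\<close> is positive iff the vertices not related to \<open>b\<close> carry mass less than \<open>e\<close>.
  If \<open>e\<close> is at most \<open>1 / card B\<close>, the vertices unrelated to some \<open>b\<close> of positive weight carry mass
  less than \<open>1\<close>, so some vertex is related to every \<open>b\<close> of positive weight.
\<close>

definition dowker_weight ::
    "'a set \<Rightarrow> ('a \<Rightarrow> 'b \<Rightarrow> bool) \<Rightarrow> real \<Rightarrow> ('a \<Rightarrow> real) \<Rightarrow> 'b \<Rightarrow> real" where
  "dowker_weight A R e f b = max 0 ((\<Sum>a\<in>A. if R a b then f a else 0) - (1 - e))"

definition dowker_map ::
    "'a set \<Rightarrow> 'b set \<Rightarrow> ('a \<Rightarrow> 'b \<Rightarrow> bool) \<Rightarrow> real \<Rightarrow> ('a \<Rightarrow> real) \<Rightarrow> 'b \<Rightarrow> real" where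
  "dowker_map A B R e f b =
     (if b \<in> B then dowker_weight A R e f b / (\<Sum>b\<in>B. dowker_weight A R e f b) else 0)"

text \<open>Replaces the sum over the varying support by a sum over the fixed finite set
  \<open>A\<close>, so that weights are finite sums of coordinates. A support of total mass
  \<open>1\<close> is automatically nonempty.\<close>

lemma geometric_realization_dowker_complex:
  assumes "finite A"
  shows "geometric_realization (dowker_complex A B R) = top_of_set (dowker_points A B R)"
proof -
  have "(\<forall>v. 0 \<le> f v) \<and> {v. f v \<noteq> 0} \<in> dowker_complex A B R \<and> (\<Sum>v | f v \<noteq> 0. f v) = 1
      \<longleftrightarrow> f \<in> dowker_points A B R" for f
  proof (cases "{v. f v \<noteq> 0} \<subseteq> A")
    case True
    then have "(\<Sum>v | f v \<noteq> 0. f v) = sum f A"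
      by (intro sum.mono_neutral_left assms) auto
    moreover have "\<exists>v. f v \<noteq> 0" if "sum f A = 1"
      using that by (metis sum.neutral zero_neq_one)
    ultimately show ?thesis
      using True finite_subset[OF True assms]
      by (auto simp: dowker_complex_def dowker_points_def)
  next
    case False
    then show ?thesis
      by (auto simp: dowker_complex_def dowker_points_def)
  qed
  then show ?thesis
    by (simp add: geometric_realization_def)
qed

section \<open>The map between the two realizations\<close>

lemma dowker_weight_nonneg: "0 \<le> dowker_weight A R e f b"
  by (simp add: dowker_weight_def)

lemma dowker_weight_le:
  assumes "f \<in> dowker_points A B R" "0 \<le> e"
  shows "dowker_weight A R e f b \<le> e"
proof -
  have "(\<Sum>a\<in>A. if R a b then f a else 0) \<le> sum f A"
    using assms by (intro sum_mono) (auto simp: dowker_points_def)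
  then show ?thesis
    using assms by (simp add: dowker_weight_def dowker_points_def)
qed

lemma dowker_weight_eq:
  assumes "f \<in> dowker_points A B R" "0 \<le> e" "\<And>a. f a \<noteq> 0 \<Longrightarrow> R a b"
  shows "dowker_weight A R e f b = e"
proof -
  have "(\<Sum>a\<in>A. if R a b then f a else 0) = sum f A"
    using assms(3) by (intro sum.cong) auto
  then show ?thesis
    using assms by (simp add: dowker_weight_def dowker_points_def)
qed

text \<open>Justifies the normalization: any \<open>b\<close> related to the whole support of
  \<open>f\<close> has weight \<open>e\<close>.\<close>

lemma sum_dowker_weight_pos:
  assumes "finite B" "f \<in> dowker_points A B R" "0 < e"
  shows "0 < (\<Sum>b\<in>B. dowker_weight A R e f b)"
proof -
  obtain b where "b \<in> B" "\<And>a. f a \<noteq> 0 \<Longrightarrow> R a b"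
    using assms(2) by (auto simp: dowker_points_def)
  then have "0 < dowker_weight A R e f b"
    using assms dowker_weight_eq[of f A B R e b] by auto
  then show ?thesis
    using \<open>b \<in> B\<close> assms(1) by (intro sum_pos2[of _ b]) (auto simp: dowker_weight_nonneg)
qed

lemma dowker_map_in_dowker_points:
  fixes e :: real
  assumes fin: "finite A" "finite B" and f: "f \<in> dowker_points A B R"
    and e: "0 < e" "e * card B \<le> 1"
  shows "dowker_map A B R e f \<in> dowker_points B A (\<lambda>b a. R a b)"
proof -
  let ?w = "dowker_weight A R e f"
  let ?P = "{b \<in> B. 0 < ?w b}"
  have pos: "0 < (\<Sum>b\<in>B. ?w b)"
    by (rule sum_dowker_weight_pos) fact+
  have fnn: "0 \<le> f a" for a
    using f by (auto simp: dowker_points_def)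
  have "\<exists>a\<in>A. \<forall>b\<in>?P. R a b"
  proof (rule ccontr)
    assume "\<not> ?thesis"
    then have ex: "\<exists>b\<in>?P. \<not> R a b" if "a \<in> A" for a
      using that by auto
    \<comment> \<open>Nonemptiness of \<open>?P\<close> is what makes the sum estimate below
      strict.\<close>
    have P_ne: "?P \<noteq> {}"
    proof
      assume "?P = {}"
      then have "?w b = 0" if "b \<in> B" for b
        using that dowker_weight_nonneg[of A R e f b] by force
      with pos show False
        by simp
    qed
    \<comment> \<open>Double counting: each \<open>a\<close> is unrelated to some \<open>b\<close>
      in \<open>?P\<close>, so the total mass is at most the sum over \<open>?P\<close> of the
      masses unrelated to \<open>b\<close>. Each of these is below \<open>e\<close>, and
      \<open>e * card B \<le> 1\<close>.\<close>
    have "1 = sum f A"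
      using f by (auto simp: dowker_points_def)
    also have "\<dots> \<le> (\<Sum>a\<in>A. \<Sum>b\<in>?P. if R a b then 0 else f a)"
    proof (rule sum_mono)
      fix a assume "a \<in> A"
      then obtain b where b: "b \<in> ?P" "\<not> R a b"
        using ex by blast
      then have "f a = (\<Sum>b\<in>{b}. if R a b then 0 else f a)"
        by simp
      also have "\<dots> \<le> (\<Sum>b\<in>?P. if R a b then 0 else f a)"
        using b fin fnn by (intro sum_mono2) auto
      finally show "f a \<le> (\<Sum>b\<in>?P. if R a b then 0 else f a)" .
    qed
    also have "\<dots> = (\<Sum>b\<in>?P. \<Sum>a\<in>A. if R a b then 0 else f a)"
      by (rule sum.swap)
    also have "\<dots> < (\<Sum>b\<in>?P. e)"
    proof (rule sum_strict_mono)
      fix b assume b: "b \<in> ?P"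
      have "(\<Sum>a\<in>A. if R a b then 0 else f a) + (\<Sum>a\<in>A. if R a b then f a else 0) = sum f A"
        by (subst sum.distrib[symmetric]) (auto intro: sum.cong)
      also have "\<dots> = 1"
        using f by (auto simp: dowker_points_def)
      finally show "(\<Sum>a\<in>A. if R a b then 0 else f a) < e"
        using b by (auto simp: dowker_weight_def)
    qed (use fin P_ne in auto)
    also have "\<dots> \<le> e * card B"
      using e fin by (simp add: card_mono mult.commute)
    finally show False
      using e by simp
  qed
  then obtain a where "a \<in> A" and a: "\<And>b. b \<in> ?P \<Longrightarrow> R a b"
    by blast
  have "R a b" if "dowker_map A B R e f b \<noteq> 0" for b
    using that dowker_weight_nonneg[of A R e f b]
    by (intro a) (auto simp: dowker_map_def split: if_splits)
  with \<open>a \<in> A\<close> have "\<exists>a\<in>A. \<forall>b. dowker_map A B R e f b \<noteq> 0 \<longrightarrow> R a b"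
    by blast
  moreover have "sum (dowker_map A B R e f) B = 1"
    using pos by (simp add: dowker_map_def flip: sum_divide_distrib)
  moreover have "0 \<le> dowker_map A B R e f b" for b
    using pos by (auto simp: dowker_map_def dowker_weight_nonneg intro!: divide_nonneg_pos)
  ultimately show ?thesis
    \<comment> \<open>The first \<open>simp\<close> keeps \<open>dowker_map\<close> folded to match
      the collected facts; only its vanishing outside \<open>B\<close> remains for the
      second.\<close>
    by (simp add: dowker_points_def) (simp add: dowker_map_def)
qed

text \<open>
  A \<open>b\<close> related to the whole support of \<open>f\<close> has maximal weight, hence mass at least \<open>1 / card B\<close>
  in the image of \<open>f\<close>. So the round trip stays in the simplex given by \<open>b\<close>.
\<close>

lemma dowker_map_support:
  fixes e e' :: real
  assumes fin: "finite A" "finite B" and f: "f \<in> dowker_points A B R"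
    and e: "0 < e" "e * card B \<le> 1" and e': "e' * card B \<le> 1"
    and b: "b \<in> B" "\<And>a. f a \<noteq> 0 \<Longrightarrow> R a b"
    and nz: "dowker_map B A (\<lambda>b a. R a b) e' (dowker_map A B R e f) a \<noteq> 0"
  shows "R a b"
proof (rule ccontr)
  assume "\<not> R a b"
  let ?g = "dowker_map A B R e f"
  have g: "?g \<in> dowker_points B A (\<lambda>b a. R a b)"
    by (rule dowker_map_in_dowker_points) fact+
  have B: "0 < real (card B)"
    using b fin by (auto simp: card_gt_0_iff)
  have pos: "0 < (\<Sum>b\<in>B. dowker_weight A R e f b)"
    by (rule sum_dowker_weight_pos) fact+
  have "(\<Sum>b\<in>B. dowker_weight A R e f b) \<le> (\<Sum>b\<in>B. e)"
    using f e by (intro sum_mono dowker_weight_le) auto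
  moreover have "dowker_weight A R e f b = e"
    using f e b by (intro dowker_weight_eq) auto
  ultimately have "1 / card B \<le> ?g b"
    using b e B pos by (simp add: dowker_map_def field_simps)
  moreover have "e' \<le> 1 / card B"
    using e' B by (simp add: field_simps)
  ultimately have "e' \<le> ?g b"
    by linarith
  \<comment> \<open>As \<open>a\<close> is unrelated to \<open>b\<close>, the mass related to
    \<open>a\<close> is at most \<open>1 - ?g b\<close>, hence at most \<open>1 - e'\<close>, and
    the truncation at \<open>0\<close> removes \<open>a\<close>.\<close>
  have "(\<Sum>b\<in>B. if R a b then ?g b else 0) = (\<Sum>b\<in>B - {b}. if R a b then ?g b else 0)"
    using \<open>\<not> R a b\<close> b fin by (subst sum.remove[of B b]) auto
  also have "\<dots> \<le> (\<Sum>b\<in>B - {b}. ?g b)"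
    using g by (intro sum_mono) (auto simp: dowker_points_def)
  also have "\<dots> = 1 - ?g b"
    using g b fin by (simp add: sum_diff1 dowker_points_def)
  finally have "dowker_weight B (\<lambda>b a. R a b) e' ?g a = 0"
    using \<open>e' \<le> ?g b\<close> by (simp add: dowker_weight_def)
  then show False
    using nz by (simp add: dowker_map_def split: if_splits)
qed

lemma continuous_on_dowker_map:
  assumes "finite A" "finite B" "0 < e"
  shows "continuous_on (dowker_points A B R) (dowker_map A B R e)"
proof (rule continuous_on_coordinatewise_then_product)
  fix b
  have "continuous_on (dowker_points A B R) (\<lambda>f. dowker_weight A R e f b)" for b
  proof -
    have "continuous_on (dowker_points A B R) (\<lambda>f. if R a b then f a else 0)" for a
      by (cases "R a b") (auto intro: continuous_on_product_then_coordinatewise continuous_on_id)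
    then show ?thesis
      unfolding dowker_weight_def by (intro continuous_intros)
  qed
  moreover have "(\<Sum>b\<in>B. dowker_weight A R e f b) \<noteq> 0" if "f \<in> dowker_points A B R" for f
    using sum_dowker_weight_pos[OF assms(2) that assms(3)] by simp
  ultimately show "continuous_on (dowker_points A B R) (\<lambda>f. dowker_map A B R e f b)"
    unfolding dowker_map_def by (cases "b \<in> B") (auto intro!: continuous_intros)
qed

text \<open>The \<open>b\<close> in \<open>common\<close> spans a simplex containing both
  \<open>f\<close> and \<open>h f\<close>, hence the whole segment between them, so the
  straight-line homotopy stays in the realization.\<close>

lemma homotopic_with_dowker_points_id:
  assumes h: "continuous_on (dowker_points A B R) h"
    "h \<in> dowker_points A B R \<rightarrow> dowker_points A B R"
    and common: "\<And>f. f \<in> dowker_points A B R \<Longrightarrow>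
      \<exists>b\<in>B. \<forall>a. f a \<noteq> 0 \<or> h f a \<noteq> 0 \<longrightarrow> R a b"
  shows "homotopic_with (\<lambda>x. True) (top_of_set (dowker_points A B R))
           (top_of_set (dowker_points A B R)) h id"
proof -
  let ?X = "dowker_points A B R"
  let ?H = "\<lambda>(t, f) a. (1 - t) * h f a + t * f a :: real"
  have "continuous_on ({0..1} \<times> ?X) ?H"
  proof (rule continuous_on_coordinatewise_then_product)
    fix a
    have "continuous_on ({0..1} \<times> ?X) (\<lambda>p. h (snd p))"
      using h by (intro continuous_on_compose2[OF h(1)] continuous_on_snd continuous_on_id) auto
    then have "continuous_on ({0..1} \<times> ?X) (\<lambda>p. h (snd p) a)"
      by (rule continuous_on_product_then_coordinatewise)
    moreover have "continuous_on ({0..1} \<times> ?X) (\<lambda>p. snd p a)"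
      by (rule continuous_on_product_then_coordinatewise) (intro continuous_intros)
    ultimately show "continuous_on ({0..1} \<times> ?X) (\<lambda>p. ?H p a)"
      unfolding case_prod_unfold by (intro continuous_intros)
  qed
  moreover have "?H (t, f) \<in> ?X" if "t \<in> {0..1}" "f \<in> ?X" for t f
  proof -
    obtain b where b: "b \<in> B" "\<And>a. f a \<noteq> 0 \<or> h f a \<noteq> 0 \<Longrightarrow> R a b"
      using common[OF \<open>f \<in> ?X\<close>] by blast
    have "h f \<in> ?X"
      using h that by auto
    moreover have "(\<Sum>a\<in>A. (1 - t) * h f a + t * f a) = (1 - t) * sum (h f) A + t * sum f A"
      by (simp add: sum.distrib sum_distrib_left)
    moreover have "R a b" if "(1 - t) * h f a + t * f a \<noteq> 0" for a
      using that by (intro b) auto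
    ultimately show ?thesis
      using that b(1) by (auto simp: dowker_points_def)
  qed
  ultimately show ?thesis
    unfolding homotopic_with_def
    by (intro exI[of _ ?H])
      (auto simp: id_def)
qed

lemma dowker_duality:
  assumes fin: "finite A" "finite B"
  shows "geometric_realization (dowker_complex A B R) homotopy_equivalent_space
         geometric_realization (dowker_complex B A (\<lambda>b a. R a b))"
proof -
  \<comment> \<open>One \<open>e\<close> is small enough for both directions; the summand
    \<open>1\<close> keeps the denominator positive even if both sets are empty.\<close>
  define e :: real where "e = 1 / (card A + card B + 1)"
  have e: "0 < e" "e * card A \<le> 1" "e * card B \<le> 1"
    by (auto simp: e_def field_simps)
  \<comment> \<open>Stated for arbitrary types, so that it covers both composites by exchanging the
    roles of \<open>A\<close> and \<open>B\<close>.\<close>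
  have hom: "homotopic_with (\<lambda>x. True) (top_of_set (dowker_points X Y Q)) 
      (top_of_set (dowker_points X Y Q))
      (dowker_map Y X (\<lambda>y x. Q x y) e \<circ> dowker_map X Y Q e) id"
    if XY: "finite X" "finite Y" "e * card X \<le> 1" "e * card Y \<le> 1"
    for X :: "'x set" and Y :: "'y set" and Q
  proof (rule homotopic_with_dowker_points_id)
    have into: "dowker_map X Y Q e \<in> dowker_points X Y Q \<rightarrow> dowker_points Y X (\<lambda>y x. Q x y)"
      using XY e dowker_map_in_dowker_points[of X Y _ Q e] by auto
    moreover have "dowker_map Y X (\<lambda>y x. Q x y) e
        \<in> dowker_points Y X (\<lambda>y x. Q x y) \<rightarrow> dowker_points X Y Q"
      using XY e dowker_map_in_dowker_points[of Y X _ "\<lambda>y x. Q x y" e] by auto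
    ultimately show "dowker_map Y X (\<lambda>y x. Q x y) e \<circ> dowker_map X Y Q e
        \<in> dowker_points X Y Q \<rightarrow> dowker_points X Y Q"
      by auto
    show "continuous_on (dowker_points X Y Q)
        (dowker_map Y X (\<lambda>y x. Q x y) e \<circ> dowker_map X Y Q e)"
      using XY e into
      by (intro continuous_on_compose continuous_on_dowker_map
          continuous_on_subset[OF continuous_on_dowker_map[where R = "\<lambda>y x. Q x y"]]) auto
    fix f assume f: "f \<in> dowker_points X Y Q"
    then obtain y where "y \<in> Y" "\<And>x. f x \<noteq> 0 \<Longrightarrow> Q x y"
      by (auto simp: dowker_points_def)
    then show "\<exists>y\<in>Y. \<forall>x. f x \<noteq> 0 \<or>
        (dowker_map Y X (\<lambda>y x. Q x y) e \<circ> dowker_map X Y Q e) f x \<noteq> 0 \<longrightarrow> Q x y"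
      using dowker_map_support[OF XY(1,2) f e(1) XY(4) XY(4)] by (metis comp_apply)
  qed
  show ?thesis
    unfolding geometric_realization_dowker_complex[OF fin(1)]
      geometric_realization_dowker_complex[OF fin(2)] homotopy_equivalent_space_def
  proof (intro exI conjI)
    show "continuous_map (top_of_set (dowker_points A B R))
        (top_of_set (dowker_points B A (\<lambda>b a. R a b))) (dowker_map A B R e)"
      using fin e by (auto simp: continuous_map_subtopology_eu
          intro!: continuous_on_dowker_map dowker_map_in_dowker_points)
    show "continuous_map (top_of_set (dowker_points B A (\<lambda>b a. R a b)))
        (top_of_set (dowker_points A B R)) (dowker_map B A (\<lambda>b a. R a b) e)"
      using fin e dowker_map_in_dowker_points[of B A _ "\<lambda>b a. R a b" e]
      by (auto simp: continuous_map_subtopology_eu intro!: continuous_on_dowker_map)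
  qed (use hom[of A B R] hom[of B A "\<lambda>b a. R a b"] fin e in auto)
qed


section \<open>Cliques of the partition graph\<close>

definition diagram :: "nat list \<Rightarrow> (nat \<times> nat) set" where
  "diagram xs = {(i, k). k < row_length xs i}"

text \<open>
  Unlike row lengths, column lengths are invariant under reordering the rows, so the effect of
  a move on the diagram is read off them.
\<close>

definition column_length :: "nat list \<Rightarrow> nat \<Rightarrow> nat" where
  "column_length xs k = length (filter (\<lambda>x. k < x) xs)"

section \<open>Diagrams and row lengths\<close>

lemma mem_diagram [simp]: "(i, k) \<in> diagram xs \<longleftrightarrow> k < row_length xs i"
  by (simp add: diagram_def)

lemma diagram_eq_Sigma: "diagram xs = Sigma {..<length xs} (\<lambda>i. {..<xs ! i})"
  by (auto simp: diagram_def row_length_def split: if_splits)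

lemma finite_diagram [simp]: "finite (diagram xs)"
  by (simp add: diagram_eq_Sigma)

lemma card_diagram: "card (diagram xs) = sum_list xs"
  by (simp add: diagram_eq_Sigma sum_list_sum_nth atLeast0LessThan)

lemma row_length_pos_iff:
  assumes "is_partition n xs"
  shows "0 < row_length xs i \<longleftrightarrow> i < length xs"
  using assms by (auto simp: is_partition_def row_length_def)

lemma row_length_antimono:
  assumes "is_partition n xs" "i \<le> j"
  shows "row_length xs j \<le> row_length xs i"
  using assms
  by (cases "i = j") (auto simp: is_partition_def row_length_def sorted_wrt_iff_nth_less)

text \<open>The default \<open>0\<close> beyond the end makes \<open>row_length\<close> blind to
  trailing zeros, and the positive entries of \<open>ys\<close> leave no other ambiguity.\<close>

lemma list_eq_if_row_length_eq:
  assumes "is_partition n ys" "row_length xs = row_length ys"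
  shows "xs = ys @ replicate (length xs - length ys) 0"
proof (rule nth_equalityI)
  have "i < length xs" if "i < length ys" for i
    using row_length_pos_iff[OF assms(1), of i] that
    unfolding assms(2)[symmetric] by (auto simp: row_length_def split: if_splits)
  then have "length ys \<le> length xs"
    by (meson leI less_irrefl)
  then show "length xs = length (ys @ replicate (length xs - length ys) 0)"
    by simp
  show "xs ! i = (ys @ replicate (length xs - length ys) 0) ! i" if "i < length xs" for i
    using that fun_cong[OF assms(2), of i] by (auto simp: row_length_def nth_append split: if_splits)
qed

lemma partition_eqI:
  assumes "is_partition n xs" "is_partition m ys" "row_length xs = row_length ys"
  shows "xs = ys"
proof -
  have "i < length xs \<longleftrightarrow> i < length ys" for i
    using row_length_pos_iff[OF assms(1), of i] row_length_pos_iff[OF assms(2), of i] assms(3)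
    by simp
  then have "length xs = length ys"
    by (metis less_irrefl linorder_neqE_nat)
  then show ?thesis
    using list_eq_if_row_length_eq[OF assms(2,3)] by simp
qed

lemma diagram_inject:
  assumes "is_partition n xs" "is_partition m ys" "diagram xs = diagram ys"
  shows "xs = ys"
proof (rule partition_eqI[OF assms(1,2)], rule ext)
  fix i
  have "k < row_length xs i \<longleftrightarrow> k < row_length ys i" for k
    using assms(3) mem_diagram by metis
  then show "row_length xs i = row_length ys i"
    by (metis less_irrefl linorder_neqE_nat)
qed

text \<open>Covers the moves that need no permutation of rows: only trailing zeros are
  dropped.\<close>

lemma reorder_eq:
  assumes "is_partition n ys" "row_length xs = row_length ys"
  shows "reorder xs = ys"
proof -
  have "filter (\<lambda>x. 0 < x) xs = ys"
    using assms(1)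
    by (subst list_eq_if_row_length_eq[OF assms]) (simp add: is_partition_def)
  moreover have "sorted (rev ys)"
    using assms(1) by (simp add: is_partition_def sorted_wrt_rev)
  then have "sort ys = rev ys"
    by (intro properties_for_sort) simp_all
  ultimately show ?thesis
    by (simp add: reorder_def)
qed

text \<open>In a weakly decreasing list the rows longer than \<open>k\<close> form an initial
  segment, so their number exceeds \<open>i\<close> exactly when row \<open>i\<close> is among
  them.\<close>

lemma less_column_length_iff:
  assumes "sorted_wrt (\<ge>) xs"
  shows "i < column_length xs k \<longleftrightarrow> k < row_length xs i"
  using assms
proof (induction xs arbitrary: i)
  case Nil
  then show ?case
    by (simp add: column_length_def row_length_def)
next
  case (Cons x xs)
  have "xs ! i \<le> x" if "i < length xs" for i
    using Cons.prems that by simp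
  then have le: "row_length xs i \<le> x" for i
    by (simp add: row_length_def)
  have "column_length (x # xs) k = of_bool (k < x) + column_length xs k"
    "row_length (x # xs) i = (case i of 0 \<Rightarrow> x | Suc j \<Rightarrow> row_length xs j)"
    by (auto simp: column_length_def row_length_def split: nat.split)
  \<comment> \<open>If \<open>k \<ge> x\<close>, no later row is longer than \<open>k\<close>
    either; \<open>Cons.IH[of 0]\<close> turns this into an empty column of the tail.\<close>
  then show ?case
    using Cons.IH[of 0] Cons.IH[of i] Cons.IH[of "i - 1"] Cons.prems le[of 0] le[of i] le[of "i - 1"]
    by (cases i) (auto split: if_splits)
qed

section \<open>The effect of a move on columns\<close>

lemma column_length_reorder: "column_length (reorder xs) k = column_length xs k"
proof -
  have "mset (filter (\<lambda>x. k < x) (reorder xs)) = mset (filter (\<lambda>x. k < x) xs)"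
    by (auto simp: reorder_def filter_filter_mset intro: filter_mset_cong)
  then show ?thesis
    unfolding column_length_def by (metis size_mset)
qed

lemma column_length_update:
  assumes "i < length xs"
  shows "column_length (xs[i := x]) k + of_bool (k < xs ! i) = column_length xs k + of_bool (k < x)"
  using assms
proof (induction xs arbitrary: i)
  case (Cons y xs)
  then show ?case
    using Cons.IH[of "i - 1"] by (cases i) (auto simp: column_length_def)
qed simp

text \<open>One cell leaves the column in which row \<open>i\<close> ends and one enters the column
  just past the end of row \<open>j\<close>. The additive form avoids truncated subtraction of
  column lengths.\<close>

lemma column_length_move_cell:
  assumes "is_partition n xs" "i < length xs" "j \<le> length xs" "i \<noteq> j"
  shows "column_length (move_cell xs i j) k + of_bool (k = row_length xs i - 1)
    = column_length xs k + of_bool (k = row_length xs j)"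
proof -
  let ?ys = "xs @ [0]"
  let ?zs = "?ys[i := ?ys ! i - 1]"
  have nth: "?ys ! i = row_length xs i" "?ys ! j = row_length xs j"
    using assms(2,3) by (simp_all add: row_length_def nth_append)
  have pos: "0 < row_length xs i"
    using row_length_pos_iff[OF assms(1)] assms(2) by simp
  have col: "column_length ?ys k = column_length xs k"
    by (simp add: column_length_def)
  have "column_length ?zs k + of_bool (k < row_length xs i)
      = column_length xs k + of_bool (k < row_length xs i - 1)"
    using column_length_update[of i ?ys "?ys ! i - 1" k] assms(2) unfolding nth col by simp
  moreover have "column_length (?zs[j := ?ys ! j + 1]) k + of_bool (k < row_length xs j)
      = column_length ?zs k + of_bool (k < row_length xs j + 1)"
    using column_length_update[of j ?zs "?ys ! j + 1" k] assms(3,4) nth(2) by simp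
  moreover have "column_length (move_cell xs i j) k = column_length (?zs[j := ?ys ! j + 1]) k"
    by (simp add: move_cell_def Let_def column_length_reorder)
  moreover have
    "(of_bool (k < row_length xs i) :: nat)
      = of_bool (k < row_length xs i - 1) + of_bool (k = row_length xs i - 1)"
    "(of_bool (k < row_length xs j + 1) :: nat)
      = of_bool (k < row_length xs j) + of_bool (k = row_length xs j)"
    using pos by (auto simp: of_bool_def)
  ultimately show ?thesis
    by linarith
qed

lemma mem_diagram_iff_column:
  assumes "is_partition n xs"
  shows "(i, k) \<in> diagram xs \<longleftrightarrow> i < column_length xs k"
  using assms by (simp add: less_column_length_iff is_partition_def)

section \<open>Adjacency as the exchange of one cell\<close>

lemma card_diagram_partition: "xs \<in> partitions n \<Longrightarrow> card (diagram xs) = n"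
  by (simp add: card_diagram partitions_def is_partition_def)

lemma card_diagram_diff_commute:
  assumes "xs \<in> partitions n" "ys \<in> partitions n"
  shows "card (diagram xs - diagram ys) = card (diagram ys - diagram xs)"
  using card_diagram_partition[OF assms(1)] card_diagram_partition[OF assms(2)]
  by (simp add: card_Diff_subset_Int Int_commute)

lemma obtained_by_move_card_diff:
  assumes "xs \<in> partitions n" "ys \<in> partitions n" "obtained_by_move xs ys"
  shows "card (diagram xs - diagram ys) \<le> 1"
proof -
  obtain i j where ij: "i < length xs" "j \<le> length xs" "i \<noteq> j" and ys: "ys = move_cell xs i j"
    using assms(3) by (auto simp: obtained_by_move_def)
  have p: "is_partition n xs" "is_partition n ys"
    using assms by (auto simp: partitions_def)
  let ?k = "row_length xs i - 1"
  \<comment> \<open>Only column \<open>?k\<close> can get shorter, and by at most one cell; a lost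
    cell was its lowest, so its row number is the new column length.\<close>
  have "diagram xs - diagram ys \<subseteq> {(column_length ys ?k, ?k)}"
  proof clarify
    fix r k assume "(r, k) \<in> diagram xs" "(r, k) \<notin> diagram ys"
    then have "r < column_length xs k" "column_length ys k \<le> r"
      using mem_diagram_iff_column[OF p(1), of r k] mem_diagram_iff_column[OF p(2), of r k]
      by auto
    then show "r = column_length ys ?k \<and> k = ?k"
      using column_length_move_cell[OF p(1) ij, of k] ys
      by (cases "k = ?k"; cases "k = row_length xs j") auto
  qed
  then show ?thesis
    using card_mono[of "{(column_length ys ?k, ?k)}"] by force
qed

lemma addable_cornersI:
  assumes xs: "is_partition n xs" and a: "a \<le> length xs"
    and less: "0 < a \<Longrightarrow> row_length xs a < row_length xs (a - 1)"
  shows "a \<in> addable_corners xs"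
proof -
  let ?zs = "add_cell xs a"
  have row: "row_length ?zs i = row_length xs i + of_bool (i = a)" for i
    using a by (auto simp: add_cell_def row_length_def nth_append nth_list_update)
  have "row_length ?zs j \<le> row_length ?zs i" if "i < j" for i j
  \<comment> \<open>Only the enlarged row \<open>a\<close> could exceed a row above it, and the row
    directly above is strictly longer than the old row \<open>a\<close>.\<close>
  proof (cases "j = a")
    case True
    then have "row_length xs (a - 1) \<le> row_length xs i" "0 < a"
      using that row_length_antimono[OF xs, of i "a - 1"] by auto
    then show ?thesis
      using less True that by (simp add: row)
  next
    case False
    then show ?thesis
      using row_length_antimono[OF xs, of i j] that by (simp add: row)
  qed
  then have "sorted_wrt (\<ge>) ?zs"
    unfolding sorted_wrt_iff_nth_less row_length_def by fastforce
  moreover have "\<forall>x\<in>set ?zs. 0 < x"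
    using xs set_update_subset_insert[of xs a "xs ! a + 1"]
    by (auto simp: is_partition_def add_cell_def)
  moreover have "sum_list ?zs = sum_list xs + 1"
    by (auto simp: add_cell_def sum_list_update)
  ultimately show ?thesis
    using a by (simp add: addable_corners_def is_partition_def)
qed

lemma addable_cornersD:
  assumes "a \<in> addable_corners xs" "0 < a"
  shows "row_length xs a < row_length xs (a - 1)"
proof -
  let ?zs = "add_cell xs a"
  have "is_partition (sum_list xs + 1) ?zs" "a \<le> length xs"
    using assms by (auto simp: addable_corners_def)
  then have "row_length ?zs a \<le> row_length ?zs (a - 1)"
    by (intro row_length_antimono) auto
  moreover have "row_length ?zs i = row_length xs i + of_bool (i = a)" for i
    using \<open>a \<le> length xs\<close> by (auto simp: add_cell_def row_length_def nth_append nth_list_update)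
  ultimately show ?thesis
    using assms(2) by (simp add: of_bool_def split: if_splits)
qed

text \<open>Both sets of cells are Ferrers diagrams, which forces \<open>p\<close> to be the last
  cell of its row and \<open>q\<close> the first free cell of another row, both at corners. The
  exchange is then literally a transfer.\<close>

lemma admissible_if_exchange:
  assumes xs: "xs \<in> partitions n" and ys: "ys \<in> partitions n"
    and p: "p \<in> diagram xs" and q: "q \<notin> diagram xs"
    and exch: "diagram ys = insert q (diagram xs - {p})"
  obtains c a where "admissible xs c a" "ys = move_cell xs c a"
    "p = (c, row_length xs c - 1)" "q = (a, row_length xs a)"
proof -
  obtain c m a k where pq: "p = (c, m)" "q = (a, k)"
    by fastforce
  have px: "is_partition n xs" and py: "is_partition n ys"
    using xs ys by (auto simp: partitions_def)
  have m: "m < row_length xs c" and k: "row_length xs a \<le> k"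
    using p q pq by auto
  have rows: "j < row_length ys i \<longleftrightarrow>
      (i = a \<and> j = k) \<or> (j < row_length xs i \<and> \<not> (i = c \<and> j = m))" for i j
    using mem_diagram[of i j ys] mem_diagram[of i j xs] by (auto simp: exch pq)
  have sect: "{..<row_length ys i} =
      (if i = a then {k} else {}) \<union> ({..<row_length xs i} - (if i = c then {m} else {}))" for i
    by (rule set_eqI) (auto simp: rows)
  \<comment> \<open>An exchange within one row would keep its length, although the new cell lies
    beyond the old end.\<close>
  have "a \<noteq> c"
  proof
    assume "a = c"
    then have "card {..<row_length ys c} = card (insert k ({..<row_length xs c} - {m}))"
      using sect[of c] by simp
    then have "row_length ys c = row_length xs c"
      using m k \<open>a = c\<close> by simp
    then show False
      using rows[of k c] k \<open>a = c\<close> by simp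
  qed
  have "card {..<row_length ys c} = card ({..<row_length xs c} - {m})"
    using sect[of c] \<open>a \<noteq> c\<close> by simp
  then have row_c: "row_length ys c = row_length xs c - 1"
    using m by simp
  then have m_eq: "m = row_length xs c - 1"
    using rows[of "row_length xs c - 1" c] m \<open>a \<noteq> c\<close> by auto
  have "card {..<row_length ys a} = card (insert k {..<row_length xs a})"
    using sect[of a] \<open>a \<noteq> c\<close> by simp
  then have row_a: "row_length ys a = row_length xs a + 1"
    using k by simp
  then have k_eq: "k = row_length xs a"
    using rows[of k a] k by simp
  have row_le: "row_length ys i \<le> row_length xs i" if "i \<noteq> a" for i
    using sect[of i] that by (metis Diff_subset Un_empty_left lessThan_subset_iff)
  have row_eq: "row_length ys i = row_length xs i" if "i \<noteq> a" "i \<noteq> c" for i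
  proof -
    have "j < row_length ys i \<longleftrightarrow> j < row_length xs i" for j
      using rows[of j i] that by simp
    then show ?thesis
      by (metis less_irrefl linorder_neqE_nat)
  qed
  have c_len: "c < length xs"
    using m row_length_pos_iff[OF px, of c] by auto
  have a_less: "row_length xs a < row_length xs (a - 1)" if "0 < a"
  proof -
    have "row_length xs a < row_length ys (a - 1)"
      using row_a row_length_antimono[OF py, of "a - 1" a] by simp
    also have "\<dots> \<le> row_length xs (a - 1)"
      using that by (intro row_le) simp
    finally show ?thesis .
  qed
  have a_len: "a \<le> length xs"
    using a_less row_length_pos_iff[OF px, of "a - 1"] by (cases "a = 0") auto
  have "row_length xs (Suc c) \<le> row_length ys (Suc c)"
    using row_eq[of "Suc c"] row_a by (cases "Suc c = a") auto
  then have c_rem: "c \<in> removable_corners xs"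
    using row_length_antimono[OF py, of c "Suc c"] row_c m c_len
    by (simp add: removable_corners_def)
  have a_add: "a \<in> addable_corners xs"
    using px a_len a_less by (rule addable_cornersI)
  \<comment> \<open>The updated list already has the rows of \<open>ys\<close>, up to trailing
    zeros, so \<open>reorder_eq\<close> applies.\<close>
  have "row_length ((xs @ [0])[c := (xs @ [0]) ! c - 1, a := (xs @ [0]) ! a + 1]) i
      = row_length ys i" for i
    using row_eq[of i] row_a row_c c_len a_len \<open>a \<noteq> c\<close>
    by (auto simp: row_length_def nth_append nth_list_update split: if_splits)
  then have move: "move_cell xs c a = ys"
    unfolding move_cell_def Let_def by (intro reorder_eq[OF py] ext)
  have "ys \<noteq> xs"
    using row_a by auto
  then have "admissible xs c a"
    using c_rem a_add \<open>a \<noteq> c\<close> move px py by (simp add: admissible_def is_partition_def)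
  then show ?thesis
    using that move pq m_eq k_eq by blast
qed

lemma exchange_if_card_diff_le_1:
  assumes "xs \<in> partitions n" "ys \<in> partitions n" "xs \<noteq> ys"
    and "card (diagram xs - diagram ys) \<le> 1"
  obtains p q where "p \<in> diagram xs" "q \<notin> diagram xs"
    "diagram ys = insert q (diagram xs - {p})"
proof -
  have "card (diagram xs - diagram ys) \<noteq> 0"
  proof
    assume "card (diagram xs - diagram ys) = 0"
    moreover from this have "card (diagram ys - diagram xs) = 0"
      using card_diagram_diff_commute assms by metis
    ultimately have "diagram xs = diagram ys"
      by auto
    then show False
      using assms diagram_inject by (auto simp: partitions_def)
  qed
  then have c: "card (diagram xs - diagram ys) = 1"
    using assms(4) by linarith
  then obtain p where p: "diagram xs - diagram ys = {p}"
    by (auto simp: card_1_singleton_iff)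
  from c have "card (diagram ys - diagram xs) = 1"
    using card_diagram_diff_commute assms by metis
  then obtain q where q: "diagram ys - diagram xs = {q}"
    by (auto simp: card_1_singleton_iff)
  have "diagram ys = insert q (diagram xs - {p})"
    using p q by blast
  then show ?thesis
    using that p q by blast
qed

text \<open>Turns the graph into set theory on diagrams. The right-hand side is symmetric because
  both diagrams have \<open>n\<close> cells, which matches the two directions allowed in
  \<open>partition_adj\<close>.\<close>

lemma partition_adj_iff:
  assumes "xs \<in> partitions n" "ys \<in> partitions n" "xs \<noteq> ys"
  shows "partition_adj xs ys \<longleftrightarrow> card (diagram xs - diagram ys) \<le> 1"
proof
  assume "partition_adj xs ys"
  then show "card (diagram xs - diagram ys) \<le> 1"
    using obtained_by_move_card_diff[of xs n ys] obtained_by_move_card_diff[of ys n xs] assms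
      card_diagram_diff_commute[of xs n ys]
    by (auto simp: partition_adj_def)
next
  assume "card (diagram xs - diagram ys) \<le> 1"
  then obtain p q where "p \<in> diagram xs" "q \<notin> diagram xs"
      "diagram ys = insert q (diagram xs - {p})"
    using assms exchange_if_card_diff_le_1[of xs n ys] by metis
  then obtain c a where "admissible xs c a" "ys = move_cell xs c a"
    using assms admissible_if_exchange by metis
  then have "obtained_by_move xs ys"
    by (auto simp: obtained_by_move_def admissible_def removable_corners_def addable_corners_def)
  then show "partition_adj xs ys"
    using assms by (simp add: partition_adj_def)
qed

section \<open>Full simplices as containment families\<close>

lemma diagram_move_cell:
  assumes xs: "xs \<in> partitions n" and adm: "admissible xs c a"
  shows "move_cell xs c a \<in> partitions n"
    and "diagram xs - {(c, row_length xs c - 1)} \<subseteq> diagram (move_cell xs c a)"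
    and "diagram (move_cell xs c a) \<subseteq> insert (a, row_length xs a) (diagram xs)"
proof -
  let ?ys = "move_cell xs c a"
  have px: "is_partition n xs"
    using xs by (auto simp: partitions_def)
  have py: "is_partition n ?ys" and ne: "?ys \<noteq> xs"
    using adm px by (auto simp: admissible_def is_partition_def)
  then show "?ys \<in> partitions n"
    by (simp add: partitions_def)
  have corners: "c < length xs" "row_length xs (Suc c) < row_length xs c" "a \<le> length xs" "c \<noteq> a"
    and a: "a \<in> addable_corners xs"
    using adm by (auto simp: admissible_def removable_corners_def addable_corners_def)
  note col = column_length_move_cell[OF px corners(1,3,4)]
  note mem_xs = mem_diagram_iff_column[OF px] and mem_ys = mem_diagram_iff_column[OF py]
  \<comment> \<open>If the cell left and entered the same column, no column would change and the
    transfer would return \<open>xs\<close>.\<close>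
  have neq: "row_length xs c - 1 \<noteq> row_length xs a"
  proof
    assume "row_length xs c - 1 = row_length xs a"
    then have "column_length ?ys k = column_length xs k" for k
      using col[of k] by simp
    then have "diagram ?ys = diagram xs"
      using mem_xs mem_ys by auto
    then show False
      using ne diagram_inject px py by blast
  qed
  \<comment> \<open>A removable corner is the lowest cell of its column; dually,
    \<open>col_a\<close> says that an addable corner is the first free cell of its column.\<close>
  have col_c: "column_length xs (row_length xs c - 1) = Suc c"
  proof -
    have "(c, row_length xs c - 1) \<in> diagram xs" "(Suc c, row_length xs c - 1) \<notin> diagram xs"
      using corners(2) by auto
    then show ?thesis
      unfolding mem_xs by linarith
  qed
  have col_a: "column_length xs (row_length xs a) = a"
  proof -
    have "(a, row_length xs a) \<notin> diagram xs" "0 < a \<Longrightarrow> (a - 1, row_length xs a) \<in> diagram xs"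
      using addable_cornersD[OF a] by auto
    then show ?thesis
      unfolding mem_xs by linarith
  qed
  show "diagram xs - {(c, row_length xs c - 1)} \<subseteq> diagram ?ys"
  proof clarify
    fix i k assume "(i, k) \<in> diagram xs" "(i, k) \<notin> diagram ?ys"
    then have "i < column_length xs k" "column_length ?ys k \<le> i"
      using mem_xs[of i k] mem_ys[of i k] by auto
    then show "i = c \<and> k = row_length xs c - 1"
      using col[of k] col_c neq by (cases "k = row_length xs c - 1") auto
  qed
  show "diagram ?ys \<subseteq> insert (a, row_length xs a) (diagram xs)"
  proof clarify
    fix i k assume "(i, k) \<in> diagram ?ys" "(i, k) \<notin> diagram xs"
    then have "i < column_length ?ys k" "column_length xs k \<le> i"
      using mem_xs[of i k] mem_ys[of i k] by auto
    then show "i = a \<and> k = row_length xs a"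
      using col[of k] col_a neq by (cases "k = row_length xs a") auto
  qed
qed

text \<open>A partition of \<open>n\<close> containing the remaining \<open>n - 1\<close> cells is
  \<open>xs\<close> or arises from it by exchanging the corner for another cell, which is an
  admissible transfer.\<close>

lemma full_star_eq:
  assumes xs: "xs \<in> partitions n" and c: "c \<in> removable_corners xs"
  shows "full_star xs c =
    {ys \<in> partitions n. diagram xs - {(c, row_length xs c - 1)} \<subseteq> diagram ys}"
proof (intro equalityI subsetI)
  fix ys assume "ys \<in> full_star xs c"
  then show "ys \<in> {ys \<in> partitions n. diagram xs - {(c, row_length xs c - 1)} \<subseteq> diagram ys}"
    using xs diagram_move_cell[OF xs] unfolding full_star_def by blast
next
  let ?p = "(c, row_length xs c - 1)"
  fix ys assume "ys \<in> {ys \<in> partitions n. diagram xs - {?p} \<subseteq> diagram ys}"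
  then have ys: "ys \<in> partitions n" and sub: "diagram xs - diagram ys \<subseteq> {?p}"
    by auto
  show "ys \<in> full_star xs c"
  proof (cases "ys = xs")
    case True
    then show ?thesis
      by (simp add: full_star_def)
  next
    case False
    have "card (diagram xs - diagram ys) \<le> 1"
      using card_mono[OF _ sub] by simp
    then obtain p q where pq: "p \<in> diagram xs" "q \<notin> diagram xs"
        "diagram ys = insert q (diagram xs - {p})"
      using exchange_if_card_diff_le_1[of xs n ys] xs ys False by metis
    \<comment> \<open>Only the corner may be missing from \<open>ys\<close>, so it is the exchanged
      cell.\<close>
    moreover from pq have "p \<notin> diagram ys"
      by auto
    with sub pq(1) have "p = ?p"
      by blast
    ultimately obtain a where "admissible xs c a" "ys = move_cell xs c a"
      using admissible_if_exchange[OF xs ys pq] by (metis prod.inject)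
    then show ?thesis
      by (auto simp: full_star_def)
  qed
qed

text \<open>Dual to \<open>full_star_eq\<close>: the added cell is prescribed and the removed one
  varies.\<close>

lemma full_top_eq:
  assumes xs: "xs \<in> partitions n" and a: "a \<in> addable_corners xs"
  shows "full_top xs a =
    {ys \<in> partitions n. diagram ys \<subseteq> insert (a, row_length xs a) (diagram xs)}"
proof (intro equalityI subsetI)
  fix ys assume "ys \<in> full_top xs a"
  then show "ys \<in> {ys \<in> partitions n. diagram ys \<subseteq> insert (a, row_length xs a) (diagram xs)}"
    using xs diagram_move_cell[OF xs] unfolding full_top_def by blast
next
  let ?q = "(a, row_length xs a)"
  fix ys assume "ys \<in> {ys \<in> partitions n. diagram ys \<subseteq> insert ?q (diagram xs)}"
  then have ys: "ys \<in> partitions n" and sub: "diagram ys - diagram xs \<subseteq> {?q}"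
    by auto
  show "ys \<in> full_top xs a"
  proof (cases "ys = xs")
    case True
    then show ?thesis
      by (simp add: full_top_def)
  next
    case False
    have "card (diagram ys - diagram xs) \<le> 1"
      using card_mono[OF _ sub] by simp
    then have "card (diagram xs - diagram ys) \<le> 1"
      using card_diagram_diff_commute[OF xs ys] by simp
    then obtain p q where pq: "p \<in> diagram xs" "q \<notin> diagram xs"
        "diagram ys = insert q (diagram xs - {p})"
      using exchange_if_card_diff_le_1[of xs n ys] xs ys False by metis
    moreover from pq have "q \<in> diagram ys"
      by auto
    with sub pq(2) have "q = ?q"
      by blast
    ultimately obtain c where "admissible xs c a" "ys = move_cell xs c a"
      using admissible_if_exchange[OF xs ys pq] by (metis prod.inject)
    then show ?thesis
      by (auto simp: full_top_def)
  qed
qed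

text \<open>Sets of \<open>n\<close> cells that share \<open>n - 1\<close> cells, or that lie in a
  common set of \<open>n + 1\<close> cells, differ in at most one cell.\<close>

lemma full_simplex_clique:
  assumes U: "U \<in> full_simplices n" and xs: "xs \<in> U" and ys: "ys \<in> U" and ne: "xs \<noteq> ys"
  shows "partition_adj xs ys"
proof -
  consider (star) zs c where "zs \<in> partitions n" "c \<in> removable_corners zs" "U = full_star zs c"
    | (top) zs a where "zs \<in> partitions n" "a \<in> addable_corners zs" "U = full_top zs a"
    using U by (auto simp: full_simplices_def)
  then have "xs \<in> partitions n \<and> ys \<in> partitions n \<and> card (diagram xs - diagram ys) \<le> 1"
  proof cases
    case star
    let ?W = "diagram zs - {(c, row_length zs c - 1)}"
    have W: "xs \<in> partitions n" "ys \<in> partitions n" "?W \<subseteq> diagram xs" "?W \<subseteq> diagram ys"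
      using xs ys full_star_eq star by auto
    have "card (diagram xs - diagram ys) \<le> card (diagram xs - ?W)"
      using W by (intro card_mono) auto
    also have "\<dots> = card (diagram xs) - card ?W"
      using W by (intro card_Diff_subset) auto
    also have "\<dots> = n - card ?W"
      using W by (simp add: card_diagram_partition)
    also have "\<dots> \<le> 1"
      using star by (simp add: card_Diff_singleton_if card_diagram_partition) arith
    finally show ?thesis
      using W by blast
  next
    case top
    let ?W = "insert (a, row_length zs a) (diagram zs)"
    have W: "xs \<in> partitions n" "ys \<in> partitions n" "diagram xs \<subseteq> ?W" "diagram ys \<subseteq> ?W"
      using xs ys full_top_eq top by auto
    have "card (diagram xs - diagram ys) \<le> card (?W - diagram ys)"
      using W by (intro card_mono) auto
    also have "\<dots> = card ?W - card (diagram ys)"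
      using W by (intro card_Diff_subset) auto
    also have "\<dots> \<le> 1"
      using top W by (simp add: card_diagram_partition)
    finally show ?thesis
      using W by blast
  qed
  then show ?thesis
    using partition_adj_iff ne by blast
qed

text \<open>
  \<open>A\<close> and \<open>insert q (A - {p})\<close> are two members of a clique. A member \<open>Z\<close> that does not contain their
  intersection forces every member \<open>T\<close> into their union.
\<close>

lemma subset_insert_if_near:
  fixes A Z T :: "'a set"
  assumes fin: "finite A" "finite Z" "finite T"
    and card: "card A = n" "card Z = n" "card T = n"
    and p: "p \<in> A" and q: "q \<notin> A"
    and Z: "card (A - Z) \<le> 1" "card (insert q (A - {p}) - Z) \<le> 1" "\<not> A - {p} \<subseteq> Z"
    and T: "card (T - A) \<le> 1" "card (T - insert q (A - {p})) \<le> 1" "card (T - Z) \<le> 1"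
  shows "T \<subseteq> insert q A"
proof
  have near: "u = v" if "card (X - Y) \<le> 1" "finite X" "u \<in> X - Y" "v \<in> X - Y"
    for X Y :: "'a set" and u v
    using that card_le_Suc0_iff_eq[of "X - Y"] by simp
  obtain d where d: "d \<in> A" "d \<noteq> p" "d \<notin> Z"
    using Z(3) by auto
  have "A - {d} \<subseteq> Z"
    using near[OF Z(1) fin(1)] d by blast
  moreover have "q \<in> Z"
    using near[OF Z(2), of q d] fin d q by blast
  ultimately have "insert q (A - {d}) \<subseteq> Z"
    by simp
  moreover have "card (insert q (A - {d})) = card Z"
    using card_Suc_Diff1[OF fin(1) d(1)] fin card q by simp
  \<comment> \<open>So \<open>Z\<close> also arises from \<open>A\<close> by inserting
    \<open>q\<close>, but with \<open>d\<close> removed instead of \<open>p\<close>.\<close>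
  ultimately have Z_eq: "insert q (A - {d}) = Z"
    using fin by (intro card_subset_eq)
  fix t assume t: "t \<in> T"
  show "t \<in> insert q A"
  proof (rule ccontr)
    assume nt: "t \<notin> insert q A"
    \<comment> \<open>The cell \<open>t\<close> already uses up the single allowed difference from
      each of \<open>A\<close>, \<open>insert q (A - {p})\<close> and \<open>Z\<close>, so the rest
      of \<open>T\<close> lies in all three.\<close>
    have "T - {t} \<subseteq> A - {p, d}"
    proof
      fix u assume u: "u \<in> T - {t}"
      have "u \<in> A" "u \<in> insert q (A - {p})" "u \<in> Z"
        using near[OF T(1) fin(3), of u t] near[OF T(2) fin(3), of u t]
          near[OF T(3) fin(3), of u t] u t nt Z_eq by auto
      then show "u \<in> A - {p, d}"
        using d q by auto
    qed
    then have "card (T - {t}) \<le> card (A - {p, d})"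
      using fin by (intro card_mono) auto
    also have "\<dots> = n - 2"
      using d p fin card by (simp add: card_Diff_subset)
    finally have "n - 1 \<le> n - 2"
      using t card by simp
    \<comment> \<open>This gives \<open>n \<ge> 2\<close>; for smaller \<open>n\<close>, truncated
      subtraction would make \<open>n - 1 \<le> n - 2\<close> no contradiction.\<close>
    moreover have "card {p, d} \<le> card A"
      using d p fin by (intro card_mono) auto
    ultimately show False
      using card d by simp
  qed
qed

text \<open>Two distinct members fix an exchange of \<open>p\<close> for \<open>q\<close>. Either
  every member contains their intersection and the star at \<open>p\<close> works, or
  \<open>subset_insert_if_near\<close> puts every member into their union and the top at
  \<open>q\<close> works.\<close>

lemma clique_subset_full_simplex:
  assumes n: "1 \<le> n" and S: "S \<subseteq> partitions n" "S \<noteq> {}"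
    and clique: "\<And>xs ys. xs \<in> S \<Longrightarrow> ys \<in> S \<Longrightarrow> xs \<noteq> ys \<Longrightarrow> partition_adj xs ys"
  obtains U where "U \<in> full_simplices n" "S \<subseteq> U"
proof -
  have near: "card (diagram xs - diagram ys) \<le> 1" if "xs \<in> S" "ys \<in> S" for xs ys
    using clique[OF that] that S partition_adj_iff[of xs n ys] by (cases "xs = ys") auto
  obtain xs where xs: "xs \<in> S" "xs \<in> partitions n"
    using S by auto
  show ?thesis
  proof (cases "S = {xs}")
    case True
    \<comment> \<open>The last row always ends in a removable corner; \<open>1 \<le> n\<close>
      guarantees that there is a row.\<close>
    let ?c = "length xs - 1"
    have "is_partition n xs" "xs \<noteq> []"
      using xs n by (auto simp: partitions_def is_partition_def)
    then have "?c \<in> removable_corners xs"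
      using row_length_pos_iff[of n xs ?c]
      by (simp add: removable_corners_def) (simp add: row_length_def)
    then have "full_star xs ?c \<in> full_simplices n"
      using xs by (auto simp: full_simplices_def)
    then show ?thesis
      using that True by (auto simp: full_star_def)
  next
    case False
    then obtain ys where ys: "ys \<in> S" "ys \<in> partitions n" "xs \<noteq> ys"
      using xs S by blast
    obtain p q where pq: "p \<in> diagram xs" "q \<notin> diagram xs"
        "diagram ys = insert q (diagram xs - {p})"
      using exchange_if_card_diff_le_1[of xs n ys] xs ys near by metis
    obtain c a where adm: "admissible xs c a" "p = (c, row_length xs c - 1)" "q = (a, row_length xs a)"
      using admissible_if_exchange[OF xs(2) ys(2) pq] by metis
    then have corners: "c \<in> removable_corners xs" "a \<in> addable_corners xs"
      by (auto simp: admissible_def)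
    show ?thesis
    proof (cases "\<forall>zs\<in>S. diagram xs - {p} \<subseteq> diagram zs")
      case True
      then have "S \<subseteq> full_star xs c"
        using full_star_eq[OF xs(2) corners(1)] S adm by auto
      then show ?thesis
        using that xs corners by (force simp: full_simplices_def)
    next
      case False
      then obtain zs where zs: "zs \<in> S" "\<not> diagram xs - {p} \<subseteq> diagram zs"
        by blast
      have "diagram ts \<subseteq> insert q (diagram xs)" if "ts \<in> S" for ts
        using near that xs ys zs S pq card_diagram_partition
        by (intro subset_insert_if_near[of _ "diagram zs" _ n p]) (auto simp flip: pq(3))
      then have "S \<subseteq> full_top xs a"
        using full_top_eq[OF xs(2) corners(2)] S adm by auto
      then show ?thesis
        using that xs corners by (force simp: full_simplices_def)
    qed
  qed
qed

lemma full_simplices_subset: "full_simplices n \<subseteq> Pow (partitions n)"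
  unfolding full_simplices_def using full_star_eq full_top_eq by blast

lemma finite_partitions: "finite (partitions n)"
proof (rule finite_subset)
  have "length xs \<le> sum_list xs" if "\<forall>x\<in>set xs. 0 < x" for xs :: "nat list"
    using that by (induction xs) (auto simp: Suc_le_eq)
  then show "partitions n \<subseteq> {xs. set xs \<subseteq> {..n} \<and> length xs \<le> n}"
    by (auto simp: partitions_def is_partition_def member_le_sum_list)
qed (simp add: finite_lists_length_le)


section \<open>The homotopy equivalence\<close>

lemma partition_complex_eq_dowker_complex:
  assumes "1 \<le> n"
  shows "partition_complex n = dowker_complex (partitions n) (full_simplices n) (\<in>)"
proof (intro equalityI subsetI)
  fix S assume "S \<in> partition_complex n"
  then have S: "S \<subseteq> partitions n" "finite S" "S \<noteq> {}"
    "\<And>xs ys. xs \<in> S \<Longrightarrow> ys \<in> S \<Longrightarrow> xs \<noteq> ys \<Longrightarrow> partition_adj xs ys"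
    by (auto simp: partition_complex_def clique_complex_def)
  obtain U where "U \<in> full_simplices n" "S \<subseteq> U"
    using clique_subset_full_simplex[OF assms S(1,3,4)] by blast
  with S show "S \<in> dowker_complex (partitions n) (full_simplices n) (\<in>)"
    by (auto simp: dowker_complex_def)
next
  fix S assume "S \<in> dowker_complex (partitions n) (full_simplices n) (\<in>)"
  then obtain U where "U \<in> full_simplices n" "S \<subseteq> U"
    and S: "S \<subseteq> partitions n" "finite S" "S \<noteq> {}"
    by (auto simp: dowker_complex_def)
  then have "partition_adj xs ys" if "xs \<in> S" "ys \<in> S" "xs \<noteq> ys" for xs ys
    using full_simplex_clique that by blast
  with S show "S \<in> partition_complex n"
    by (auto simp: partition_complex_def clique_complex_def)
qed

text \<open>A common point of a nonempty subfamily lies in \<open>A\<close>; nonemptiness matters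
  because \<open>\<Inter>{}\<close> is the whole type.\<close>

lemma nerve_eq_dowker_complex:
  assumes "\<C> \<subseteq> Pow A"
  shows "nerve \<C> = dowker_complex \<C> A (\<lambda>U x. x \<in> U)"
proof -
  have "\<Inter>S \<noteq> {} \<longleftrightarrow> (\<exists>x\<in>A. \<forall>U\<in>S. x \<in> U)" if "S \<subseteq> \<C>" "S \<noteq> {}" for S
    using that assms by blast
  then show ?thesis
    by (auto simp: nerve_def dowker_complex_def)
qed

theorem corollary4p5:
  fixes n :: nat
  assumes "n \<ge> 1"
  shows "geometric_realization (partition_complex n) homotopy_equivalent_space
         geometric_realization (partition_nerve n)"
proof -
  have "finite (full_simplices n)"
    using finite_subset[OF full_simplices_subset] finite_partitions by blast
  then show ?thesis
    using assms dowker_duality[OF finite_partitions, of "full_simplices n" n "(\<in>)"]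
    by (simp add: partition_complex_eq_dowker_complex partition_nerve_def
        nerve_eq_dowker_complex[OF full_simplices_subset])
qed

end
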